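(* Let $(\Omega,\mathcal{F},P)$ be a probability space, let $\mathcal{X}\subseteq\mathbb{R}^d$ and $\mathcal{Y}\subseteq\mathbb{R}^m$ be Borel sets, and let $p\in(0,1)$. Let $D_C=(X_C,Y_C)$ and $D_T=(X_T,Y_T)$ be $\mathcal{X}\times\mathcal{Y}$-valued random variables on $\Omega$, and let $Z$ be a $\{0,1\}$-valued random variable on $\Omega$ with $P(Z=1)=p$ that is independent of the pair $(D_C,D_T)$. Set $D_E=(X_E,Y_E)=D_T Z+D_C(1-Z)$, and assume that $Y_E$ and $Z$ are conditionally independent given $X_E$. Let $\mathcal{D}_C,\mathcal{D}_T,\mathcal{D}_E$ denote the distributions (laws) of $D_C,D_T,D_E$. For a nonnegative random variable $W:\Omega\to\mathbb{R}_+$ with $\mathbb{E}[W]=1$, let $W\mathcal{D}_E$ be the probability distribution on $\mathcal{X}\times\mathcal{Y}$ given by $W\mathcal{D}_E(A)=\mathbb{E}[W\,I\{D_E\in A\}]$ for measurable $A\subseteq\mathcal{X}\times\mathcal{Y}$. Then: (1) $W_T=\mathbb{E}[Z\mid X_E]/p$ attains the minimum of the optimization problem $$\min_{W:\Omega\to\mathbb{R}_+}\left\{\mathbb{E}[W^2] : W\mathcal{D}_E=\mathcal{D}_T\right\};$$ (2) $W_C=(1-\mathbb{E}[Z\mid X_E])/(1-p)$ attains the minimum of the optimization problem $$\min_{W:\Omega\to\mathbb{R}_+}\left\{\mathbb{E}[W^2] : W\mathcal{D}_E=\mathcal{D}_C\right\}.$$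
   Context: Here $D_C$ and $D_T$ represent a control data point and a treatment data point (features and outcome), $Z$ is the random treatment assignment, and $D_E$ is the data point obtained in the experiment: $D_E=D_T$ on $\{Z=1\}$ and $D_E=D_C$ on $\{Z=0\}$. $I\{\cdot\}$ denotes the indicator function and $\mathbb{R}_+=[0,\infty)$. In the optimization problems, $W$ ranges over all $\mathcal{F}$-measurable functions $W:\Omega\to\mathbb{R}_+$ with $\mathbb{E}[W]=1$ (not only functions of $(X_E,Y_E,Z)$), and the constraint is equality of probability distributions on $\mathcal{X}\times\mathcal{Y}$. "Attains the minimum" means that the given random variable (for a nonnegative version of the conditional expectation, with values in $[0,1]$) satisfies the constraint and that its second moment is at most $\mathbb{E}[W^2]$ for every feasible $W$. *)

theory Defs
  imports "HOL-Probability.Probability"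
begin

text \<open>The \<sigma>-algebra on \<open>space M\<close> generated by a function \<open>X\<close> with values in \<open>N\<close>.
  Only the space and the sets matter; the measure of a \<open>vimage_algebra\<close> is zero.\<close>

abbreviation gen_sigma :: "'w measure \<Rightarrow> ('w \<Rightarrow> 'a) \<Rightarrow> 'a measure \<Rightarrow> 'w measure" where
  "gen_sigma M X N \<equiv> vimage_algebra (space M) X N"

text \<open>Independence of two random variables. The library's \<open>prob_space.indep_var\<close> requires both
  variables to have the same value type, hence the formulation via the library's
  independence of set systems.\<close>

definition indep_rvs ::
  "'w measure \<Rightarrow> 'a measure \<Rightarrow> ('w \<Rightarrow> 'a) \<Rightarrow> 'b measure \<Rightarrow> ('w \<Rightarrow> 'b) \<Rightarrow> bool" where
  "indep_rvs M A X B Y \<longleftrightarrow>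
     X \<in> measurable M A \<and> Y \<in> measurable M B \<and>
     prob_space.indep_set M (sets (gen_sigma M X A)) (sets (gen_sigma M Y B))"

text \<open>A version of the conditional expectation \<open>E[f | F]\<close>. The library's \<open>real_cond_exp M F f\<close> is
  one arbitrarily chosen version.\<close>

definition cond_exp_version ::
  "'w measure \<Rightarrow> 'w measure \<Rightarrow> ('w \<Rightarrow> real) \<Rightarrow> ('w \<Rightarrow> real) \<Rightarrow> bool" where
  "cond_exp_version M F f g \<longleftrightarrow>
     g \<in> borel_measurable F \<and> (AE \<omega> in M. g \<omega> = real_cond_exp M F f \<omega>)"

definition cond_indep_rvs ::
  "'w measure \<Rightarrow> 'w measure \<Rightarrow> 'a measure \<Rightarrow> ('w \<Rightarrow> 'a) \<Rightarrow> 'b measure \<Rightarrow> ('w \<Rightarrow> 'b) \<Rightarrow> bool" where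
  "cond_indep_rvs M F A X B Y \<longleftrightarrow>
     (\<forall>S\<in>sets A. \<forall>T\<in>sets B. AE \<omega> in M.
        real_cond_exp M F (\<lambda>\<omega>. indicator S (X \<omega>) * indicator T (Y \<omega>)) \<omega> =
        real_cond_exp M F (\<lambda>\<omega>. indicator S (X \<omega>)) \<omega> *
        real_cond_exp M F (\<lambda>\<omega>. indicator T (Y \<omega>)) \<omega>)"

definition weights :: "'w measure \<Rightarrow> ('w \<Rightarrow> real) set" where
  "weights M = {W \<in> borel_measurable M. (\<forall>\<omega>\<in>space M. 0 \<le> W \<omega>) \<and>
                  integrable M W \<and> (\<integral>\<omega>. W \<omega> \<partial>M) = 1}"

definition weighted_law ::
  "'w measure \<Rightarrow> 'a measure \<Rightarrow> ('w \<Rightarrow> real) \<Rightarrow> ('w \<Rightarrow> 'a) \<Rightarrow> 'a measure" where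
  "weighted_law M S W D =
     measure_of (space S) (sets S) (\<lambda>A. ennreal (\<integral>\<omega>. W \<omega> * indicator A (D \<omega>) \<partial>M))"

text \<open>The second moment may be infinite, so it is taken in \<open>[0, \<infinity>]\<close>; the Bochner integral would
  be 0 in that case.\<close>

definition second_moment :: "'w measure \<Rightarrow> ('w \<Rightarrow> real) \<Rightarrow> ennreal" where
  "second_moment M W = (\<integral>\<^sup>+\<omega>. ennreal ((W \<omega>)\<^sup>2) \<partial>M)"

definition feasible_weights ::
  "'w measure \<Rightarrow> 'a measure \<Rightarrow> ('w \<Rightarrow> 'a) \<Rightarrow> 'a measure \<Rightarrow> ('w \<Rightarrow> real) set" where
  "feasible_weights M S D Q = {W \<in> weights M. weighted_law M S W D = Q}"

definition attains_min_second_moment ::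
  "'w measure \<Rightarrow> 'a measure \<Rightarrow> ('w \<Rightarrow> 'a) \<Rightarrow> 'a measure \<Rightarrow> ('w \<Rightarrow> real) \<Rightarrow> bool" where
  "attains_min_second_moment M S D Q W \<longleftrightarrow>
     W \<in> feasible_weights M S D Q \<and>
     (\<forall>V\<in>feasible_weights M S D Q. second_moment M W \<le> second_moment M V)"

text \<open>The function in \<open>weighted_law\<close> is a measure, so \<open>measure_of\<close> does not fall back
  to the zero measure.\<close>

lemma weighted_law_eq_distr:
  assumes W: "W \<in> weights M" and D: "D \<in> measurable M S"
  shows "weighted_law M S W D = distr (density M (\<lambda>\<omega>. ennreal (W \<omega>))) S D"
proof -
  let ?N = "distr (density M (\<lambda>\<omega>. ennreal (W \<omega>))) S D"
  have Wm [measurable]: "W \<in> borel_measurable M" and nn: "\<And>\<omega>. \<omega> \<in> space M \<Longrightarrow> 0 \<le> W \<omega>"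
    and int: "integrable M W"
    using W by (auto simp: weights_def)
  note D [measurable]
  have eq: "emeasure ?N A = ennreal (\<integral>\<omega>. W \<omega> * indicator A (D \<omega>) \<partial>M)" if A [measurable]: "A \<in> sets S" for A
  proof -
    have i: "integrable M (\<lambda>\<omega>. W \<omega> * indicator A (D \<omega>))"
      by (rule Bochner_Integration.integrable_bound[OF int]) (auto simp: indicator_def)
    have "emeasure ?N A = (\<integral>\<^sup>+\<omega>. ennreal (W \<omega>) * indicator (D -` A \<inter> space M) \<omega> \<partial>M)"
      by (simp add: emeasure_distr emeasure_density)
    also have "\<dots> = (\<integral>\<^sup>+\<omega>. ennreal (W \<omega> * indicator A (D \<omega>)) \<partial>M)"
      by (rule nn_integral_cong) (auto simp: indicator_def)
    also have "\<dots> = ennreal (\<integral>\<omega>. W \<omega> * indicator A (D \<omega>) \<partial>M)"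
      by (rule nn_integral_eq_integral[OF i]) (auto simp: nn)
    finally show ?thesis .
  qed
  have "?N = measure_of (space ?N) (sets ?N) (emeasure ?N)"
    by (rule measure_of_of_measure[symmetric])
  also have "\<dots> = measure_of (space S) (sets S) (emeasure ?N)"
    by simp
  also have "\<dots> = weighted_law M S W D"
    unfolding weighted_law_def
    by (rule measure_of_eq) (auto simp: sets.space_closed eq sets.sigma_sets_eq)
  finally show ?thesis by simp
qed

lemma measure_weighted_law:
  assumes "W \<in> weights M" "D \<in> measurable M S" "A \<in> sets S"
  shows "measure (weighted_law M S W D) A = (\<integral>\<omega>. W \<omega> * indicator A (D \<omega>) \<partial>M)"
proof -
  have [measurable]: "W \<in> borel_measurable M" "D \<in> measurable M S" "A \<in> sets S"
    using assms by (auto simp: weights_def)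
  have "measure (weighted_law M S W D) A
      = measure (density M (\<lambda>\<omega>. ennreal (W \<omega>))) (D -` A \<inter> space M)"
    using assms by (simp add: weighted_law_eq_distr measure_distr)
  also have "\<dots> = enn2real (\<integral>\<^sup>+\<omega>. ennreal (W \<omega>) * indicator (D -` A \<inter> space M) \<omega> \<partial>M)"
    by (simp add: measure_def emeasure_density)
  also have "\<dots> = enn2real (\<integral>\<^sup>+\<omega>. ennreal (W \<omega> * indicator A (D \<omega>)) \<partial>M)"
    by (intro arg_cong[where f = enn2real] nn_integral_cong) (auto simp: indicator_def)
  also have "\<dots> = (\<integral>\<omega>. W \<omega> * indicator A (D \<omega>) \<partial>M)"
    using assms by (intro integral_eq_nn_integral[symmetric] AE_I2) (auto simp: weights_def)
  finally show ?thesis .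
qed

text \<open>Versions with values in \<open>[0,1]\<close> exist.\<close>

lemma cond_exp_version_exists:
  assumes "prob_space M" and X: "X \<in> measurable M N"
    and f [measurable]: "f \<in> borel_measurable M" and f01: "\<And>\<omega>. \<omega> \<in> space M \<Longrightarrow> f \<omega> \<in> {0..1}"
  shows "\<exists>g. cond_exp_version M (gen_sigma M X N) f g \<and> (\<forall>\<omega>. g \<omega> \<in> {0..1})"
proof -
  interpret prob_space M by fact
  let ?F = "gen_sigma M X N"
  interpret finite_measure_subalgebra M ?F
    by unfold_locales (use X in \<open>auto simp: subalgebra_def sets_vimage_algebra2 measurable_space\<close>)
  have int: "integrable M f"
    by (rule integrable_const_bound[where B = 1]) (use f01 in auto)
  have "AE \<omega> in M. 0 \<le> real_cond_exp M ?F f \<omega>"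
    by (rule real_cond_exp_ge_c[OF int]) (use f01 in auto)
  moreover have "AE \<omega> in M. real_cond_exp M ?F f \<omega> \<le> 1"
    by (rule real_cond_exp_le_c[OF int]) (use f01 in auto)
  ultimately have "AE \<omega> in M. max 0 (min 1 (real_cond_exp M ?F f \<omega>)) = real_cond_exp M ?F f \<omega>"
    by eventually_elim auto
  then show ?thesis
    by (intro exI[of _ "\<lambda>\<omega>. max 0 (min 1 (real_cond_exp M ?F f \<omega>))"])
       (auto simp: cond_exp_version_def)
qed

end

theory Submission
  imports Defs
begin

text \<open>Conditional independence given \<open>X\<^sub>E\<close> lets one replace \<open>I{Z = c}\<close> by \<open>P(Z = c | X\<^sub>E)\<close> when
  integrating functions of \<open>D\<^sub>E = (X\<^sub>E, Y\<^sub>E)\<close>, and independence of \<open>Z\<close> turns the former into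
  \<open>P(Z = c)\<close> times the law of the corresponding potential data point; this is feasibility. As for
  minimality, a feasible weight \<open>V\<close> and the candidate \<open>W\<close> have the same integrals against functions of
  \<open>D\<^sub>E\<close>. Since \<open>W\<close> itself is such a function, \<open>E[V W] = E[W\<^sup>2]\<close>, and \<open>2 V W \<le> V\<^sup>2 + W\<^sup>2\<close> yields
  \<open>E[W\<^sup>2] \<le> E[V\<^sup>2]\<close>.\<close>

lemma subalgebra_gen_sigma:
  assumes "X \<in> measurable M N"
  shows "subalgebra M (gen_sigma M X N)"
  using assms by (auto simp: subalgebra_def sets_vimage_algebra2 measurable_space)

text \<open>On a rectangle \<open>a \<times> b\<close>, conditional independence turns
  \<open>u\<close> times the conditional expectation of I{Y in b} into the conditional expectation
  of I{Y in b} I{Z in T}. Rectangles form an intersection-stable generator, so stating the result as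
  an equality of image measures lets uniqueness of finite measures carry it to all measurable sets
  of the product.\<close>

lemma cond_indep_distr_density_eq:
  fixes X :: "'w \<Rightarrow> 'a" and Y :: "'w \<Rightarrow> 'b" and Z :: "'w \<Rightarrow> 'c"
  assumes "prob_space M"
    and X [measurable]: "X \<in> measurable M A" and Y [measurable]: "Y \<in> measurable M B"
    and Z [measurable]: "Z \<in> measurable M C"
    and ci: "cond_indep_rvs M (gen_sigma M X A) B Y C Z"
    and T [measurable]: "T \<in> sets C"
    and u: "cond_exp_version M (gen_sigma M X A) (\<lambda>\<omega>. indicator T (Z \<omega>)) u"
    and u01: "\<And>\<omega>. \<omega> \<in> space M \<Longrightarrow> u \<omega> \<in> {0..1}"
  shows "distr (density M (\<lambda>\<omega>. ennreal (u \<omega>))) (A \<Otimes>\<^sub>M B) (\<lambda>\<omega>. (X \<omega>, Y \<omega>))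
       = distr (density M (\<lambda>\<omega>. indicator T (Z \<omega>))) (A \<Otimes>\<^sub>M B) (\<lambda>\<omega>. (X \<omega>, Y \<omega>))"
proof -
  interpret prob_space M by fact
  let ?F = "gen_sigma M X A"
  let ?U = "\<lambda>\<omega>. indicator T (Z \<omega>) :: real"
  have sub: "subalgebra M ?F"
    by (rule subalgebra_gen_sigma) fact
  interpret finite_measure_subalgebra M ?F
    by unfold_locales (fact sub)
  have uF [measurable]: "u \<in> borel_measurable ?F"
    and uAE: "AE \<omega> in M. u \<omega> = real_cond_exp M ?F ?U \<omega>"
    using u by (auto simp: cond_exp_version_def)
  have uM [measurable]: "u \<in> borel_measurable M"
    by (rule measurable_from_subalg[OF sub uF])
  have XF [measurable]: "X \<in> measurable ?F A"
    by (rule measurable_vimage_algebra1) (use measurable_space[OF X] in auto)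
  have rect: "(\<integral>\<^sup>+\<omega>. ennreal (u \<omega>) * indicator (a \<times> b) (X \<omega>, Y \<omega>) \<partial>M)
      = (\<integral>\<^sup>+\<omega>. indicator T (Z \<omega>) * indicator (a \<times> b) (X \<omega>, Y \<omega>) \<partial>M)"
    if a [measurable]: "a \<in> sets A" and b [measurable]: "b \<in> sets B" for a b
  proof -
    let ?a = "\<lambda>\<omega>. indicator a (X \<omega>) :: real" and ?b = "\<lambda>\<omega>. indicator b (Y \<omega>) :: real"
    have bnd: "integrable M f" if [measurable]: "f \<in> borel_measurable M"
      and "\<And>\<omega>. \<omega> \<in> space M \<Longrightarrow> \<bar>f \<omega>\<bar> \<le> 1" for f :: "'w \<Rightarrow> real"
      by (rule integrable_const_bound[where B = 1]) (use that in auto)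
    have i1: "integrable M (\<lambda>\<omega>. (?a \<omega> * u \<omega>) * ?b \<omega>)"
      by (rule bnd) (use u01 in \<open>auto simp: indicator_def\<close>)
    have i2: "integrable M (\<lambda>\<omega>. ?a \<omega> * (?b \<omega> * ?U \<omega>))"
      by (rule bnd) (auto simp: indicator_def)
    have ci_ab: "AE \<omega> in M. real_cond_exp M ?F (\<lambda>\<omega>. ?b \<omega> * ?U \<omega>) \<omega> =
        real_cond_exp M ?F ?b \<omega> * real_cond_exp M ?F ?U \<omega>"
      using ci a b T unfolding cond_indep_rvs_def by blast
    \<comment> \<open>\<open>?a\<close> and \<open>u\<close> are both \<open>?F\<close>-measurable,
      so their product acts as a test function and \<open>?b\<close> may be replaced by its
      conditional expectation. Since \<open>u\<close> is a version of the conditional expectation of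
      \<open>?U\<close>, conditional independence then applies pointwise a.e., and the test function
      \<open>?a\<close> alone undoes the conditioning.\<close>
    have "(\<integral>\<omega>. (?a \<omega> * u \<omega>) * ?b \<omega> \<partial>M) = (\<integral>\<omega>. (?a \<omega> * u \<omega>) * real_cond_exp M ?F ?b \<omega> \<partial>M)"
      by (rule real_cond_exp_intg(2)[OF i1, symmetric]) measurable
    also have "\<dots> = (\<integral>\<omega>. ?a \<omega> * real_cond_exp M ?F (\<lambda>\<omega>. ?b \<omega> * ?U \<omega>) \<omega> \<partial>M)"
    proof (rule integral_cong_AE)
      show "AE \<omega> in M. (?a \<omega> * u \<omega>) * real_cond_exp M ?F ?b \<omega>
          = ?a \<omega> * real_cond_exp M ?F (\<lambda>\<omega>. ?b \<omega> * ?U \<omega>) \<omega>"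
        using ci_ab uAE by eventually_elim simp
    qed measurable
    also have "\<dots> = (\<integral>\<omega>. ?a \<omega> * (?b \<omega> * ?U \<omega>) \<partial>M)"
      by (rule real_cond_exp_intg(2)[OF i2]) measurable
    finally have eq: "(\<integral>\<omega>. (?a \<omega> * u \<omega>) * ?b \<omega> \<partial>M) = (\<integral>\<omega>. ?a \<omega> * (?b \<omega> * ?U \<omega>) \<partial>M)" .
    have "(\<integral>\<^sup>+\<omega>. ennreal (u \<omega>) * indicator (a \<times> b) (X \<omega>, Y \<omega>) \<partial>M)
        = (\<integral>\<^sup>+\<omega>. ennreal ((?a \<omega> * u \<omega>) * ?b \<omega>) \<partial>M)"
      by (rule nn_integral_cong) (auto simp: indicator_def)
    also have "\<dots> = ennreal (\<integral>\<omega>. (?a \<omega> * u \<omega>) * ?b \<omega> \<partial>M)"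
      by (rule nn_integral_eq_integral[OF i1]) (use u01 in auto)
    also have "\<dots> = (\<integral>\<^sup>+\<omega>. ennreal (?a \<omega> * (?b \<omega> * ?U \<omega>)) \<partial>M)"
      unfolding eq by (rule nn_integral_eq_integral[OF i2, symmetric]) auto
    also have "\<dots> = (\<integral>\<^sup>+\<omega>. indicator T (Z \<omega>) * indicator (a \<times> b) (X \<omega>, Y \<omega>) \<partial>M)"
      by (rule nn_integral_cong) (auto simp: indicator_def)
    finally show ?thesis .
  qed
  have em: "emeasure (distr (density M f) (A \<Otimes>\<^sub>M B) (\<lambda>\<omega>. (X \<omega>, Y \<omega>))) E
      = (\<integral>\<^sup>+\<omega>. f \<omega> * indicator E (X \<omega>, Y \<omega>) \<partial>M)"
    if [measurable]: "f \<in> borel_measurable M" "E \<in> sets (A \<Otimes>\<^sub>M B)" for f E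
    by (simp add: emeasure_distr emeasure_density)
       (rule nn_integral_cong, auto simp: indicator_def)
  \<comment> \<open>The full rectangle belongs to the generator, so a constant sequence exhausts the
    space. Its mass is finite because \<open>u\<close> is at most 1 on a probability space.\<close>
  show ?thesis
  proof (rule measure_eqI_generator_eq[where A = "\<lambda>_. space A \<times> space B"
        and \<Omega> = "space A \<times> space B"])
    show "Int_stable {a \<times> b |a b. a \<in> sets A \<and> b \<in> sets B}"
      by (rule Int_stable_pair_measure_generator)
    fix E assume "E \<in> {a \<times> b |a b. a \<in> sets A \<and> b \<in> sets B}"
    then show "emeasure (distr (density M (\<lambda>\<omega>. ennreal (u \<omega>))) (A \<Otimes>\<^sub>M B) (\<lambda>\<omega>. (X \<omega>, Y \<omega>))) E
        = emeasure (distr (density M (\<lambda>\<omega>. indicator T (Z \<omega>))) (A \<Otimes>\<^sub>M B) (\<lambda>\<omega>. (X \<omega>, Y \<omega>))) E"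
      by (auto simp: em rect)
  next
    have "(\<integral>\<^sup>+\<omega>. ennreal (u \<omega>) * indicator (space A \<times> space B) (X \<omega>, Y \<omega>) \<partial>M) \<le> (\<integral>\<^sup>+\<omega>. 1 \<partial>M)"
      by (rule nn_integral_mono) (use u01 in \<open>auto simp: indicator_def\<close>)
    then show "emeasure (distr (density M (\<lambda>\<omega>. ennreal (u \<omega>))) (A \<Otimes>\<^sub>M B) (\<lambda>\<omega>. (X \<omega>, Y \<omega>)))
        (space A \<times> space B) \<noteq> \<infinity>"
      by (subst em) (auto simp: emeasure_space_1 top_unique)
  qed (auto simp: sets_pair_measure dest: sets.sets_into_space)
qed

text \<open>A feasible \<open>W\<close> that is measurable with respect to \<sigma>(D) is a version
  of E[V | D] for every feasible \<open>V\<close>, and conditioning does not increase the second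
  moment. The proof uses the equivalent identity E[V W] = E[W^2], which makes sense in
  [0, \<infinity>] without assuming that \<open>V\<close> has a finite second moment.\<close>

lemma attains_min_second_moment_if_measurable:
  assumes D [measurable]: "D \<in> measurable M S"
    and W: "W \<in> feasible_weights M S D Q"
    and WF: "W \<in> borel_measurable (gen_sigma M D S)"
    and fin: "second_moment M W < \<infinity>"
  shows "attains_min_second_moment M S D Q W"
  unfolding attains_min_second_moment_def
proof (intro conjI ballI W)
  fix V assume V: "V \<in> feasible_weights M S D Q"
  let ?F = "gen_sigma M D S"
  note [measurable] = WF
  have [measurable]: "W \<in> borel_measurable M" "V \<in> borel_measurable M"
    and nn: "\<And>\<omega>. \<omega> \<in> space M \<Longrightarrow> 0 \<le> W \<omega>" "\<And>\<omega>. \<omega> \<in> space M \<Longrightarrow> 0 \<le> V \<omega>"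
    using W V by (auto simp: feasible_weights_def weights_def)
  have sub: "subalgebra (density M f) ?F" for f
    using subalgebra_gen_sigma[OF D] by (simp add: subalgebra_def)
  have law: "distr (density M (\<lambda>\<omega>. ennreal (V \<omega>))) S D = distr (density M (\<lambda>\<omega>. ennreal (W \<omega>))) S D"
    using W V by (auto simp: feasible_weights_def weighted_law_eq_distr[symmetric])
  \<comment> \<open>The densities \<open>V\<close> and \<open>W\<close> may give different measures
    on \<open>M\<close>, but every set of \<sigma>(D) is a preimage under \<open>D\<close>, and
    there the equal laws force agreement. Restricting both measures to \<sigma>(D) allows
    \<open>W\<close> to be integrated against either one without writing \<open>W\<close> as a
    function of \<open>D\<close>.\<close>
  have restr: "restr_to_subalg (density M (\<lambda>\<omega>. ennreal (V \<omega>))) ?F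
      = restr_to_subalg (density M (\<lambda>\<omega>. ennreal (W \<omega>))) ?F"
  proof (rule measure_eqI)
    fix E assume "E \<in> sets (restr_to_subalg (density M (\<lambda>\<omega>. ennreal (V \<omega>))) ?F)"
    then have EF: "E \<in> sets ?F" by (simp add: sets_restr_to_subalg[OF sub])
    then obtain A where A: "A \<in> sets S" "E = D -` A \<inter> space M"
      using D by (auto simp: sets_vimage_algebra2 measurable_space)
    have "emeasure (density M f) E = emeasure (distr (density M f) S D) A" for f
      using A by (simp add: emeasure_distr)
    then show "emeasure (restr_to_subalg (density M (\<lambda>\<omega>. ennreal (V \<omega>))) ?F) E
        = emeasure (restr_to_subalg (density M (\<lambda>\<omega>. ennreal (W \<omega>))) ?F) E"
      by (simp add: emeasure_restr_to_subalg[OF sub EF] law)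
  qed (simp add: sets_restr_to_subalg[OF sub])
  have "(\<integral>\<^sup>+\<omega>. ennreal (V \<omega>) * ennreal (W \<omega>) \<partial>M)
      = (\<integral>\<^sup>+\<omega>. ennreal (W \<omega>) \<partial>density M (\<lambda>\<omega>. ennreal (V \<omega>)))"
    by (simp add: nn_integral_density)
  also have "\<dots> = (\<integral>\<^sup>+\<omega>. ennreal (W \<omega>) \<partial>restr_to_subalg (density M (\<lambda>\<omega>. ennreal (V \<omega>))) ?F)"
    by (rule nn_integral_subalgebra2[OF sub, symmetric]) measurable
  also have "\<dots> = (\<integral>\<^sup>+\<omega>. ennreal (W \<omega>) \<partial>density M (\<lambda>\<omega>. ennreal (W \<omega>)))"
    unfolding restr by (rule nn_integral_subalgebra2[OF sub]) measurable
  also have "\<dots> = (\<integral>\<^sup>+\<omega>. ennreal (W \<omega>) * ennreal (W \<omega>) \<partial>M)"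
    by (simp add: nn_integral_density)
  also have "\<dots> = second_moment M W"
    unfolding second_moment_def
    by (rule nn_integral_cong) (simp add: nn power2_eq_square ennreal_mult)
  finally have VW: "(\<integral>\<^sup>+\<omega>. ennreal (V \<omega>) * ennreal (W \<omega>) \<partial>M) = second_moment M W" .
  \<comment> \<open>The second moment of \<open>W\<close> is doubled so that one copy remains after
    the other is cancelled against the W^2 term of 2 V W \<le> V^2 + W^2. Cancellation in
    [0, \<infinity>] relies on \<open>fin\<close>.\<close>
  have "second_moment M W + second_moment M W = (\<integral>\<^sup>+\<omega>. 2 * (ennreal (V \<omega>) * ennreal (W \<omega>)) \<partial>M)"
    by (simp add: nn_integral_cmult VW flip: mult_2)
  also have "\<dots> \<le> (\<integral>\<^sup>+\<omega>. ennreal ((V \<omega>)\<^sup>2) + ennreal ((W \<omega>)\<^sup>2) \<partial>M)"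
  proof (rule nn_integral_mono)
    fix \<omega> assume "\<omega> \<in> space M"
    then have "2 * (ennreal (V \<omega>) * ennreal (W \<omega>)) = ennreal (2 * V \<omega> * W \<omega>)"
      by (simp add: nn ennreal_mult mult.assoc)
    also have "\<dots> \<le> ennreal ((V \<omega>)\<^sup>2 + (W \<omega>)\<^sup>2)"
      by (intro ennreal_leI sum_squares_bound)
    finally show "2 * (ennreal (V \<omega>) * ennreal (W \<omega>)) \<le> ennreal ((V \<omega>)\<^sup>2) + ennreal ((W \<omega>)\<^sup>2)"
      by simp
  qed
  also have "\<dots> = second_moment M V + second_moment M W"
    by (simp add: nn_integral_add second_moment_def)
  finally show "second_moment M W \<le> second_moment M V"
    using fin by (auto simp: add.commute[of "second_moment M V"] ennreal_add_left_cancel_le)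
qed

text \<open>This treats one arm of the experiment: \<open>T\<close> is the value set of
  \<open>Z\<close> that selects the arm, \<open>D'\<close> its potential data point,
  \<open>q\<close> its probability and \<open>u\<close> its propensity. Both claims of the theorem
  are instances. The space \<open>S\<close> may be smaller than the full product, as it is when data
  points are confined to a subset.\<close>

lemma attains_min_second_moment_propensity:
  fixes D D' :: "'w \<Rightarrow> 'a \<times> 'b" and Z :: "'w \<Rightarrow> 'c"
  assumes "prob_space M"
    and S: "sets S \<subseteq> sets (A \<Otimes>\<^sub>M B)" "fst \<in> measurable S A" "snd \<in> measurable S B"
    and D' [measurable]: "D' \<in> measurable M S" and D [measurable]: "D \<in> measurable M S"
    and Z [measurable]: "Z \<in> measurable M C" and T [measurable]: "T \<in> sets C"
    and q: "measure M {\<omega> \<in> space M. Z \<omega> \<in> T} = q" "0 < q"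
    and indep: "\<And>E. E \<in> sets S \<Longrightarrow> measure M {\<omega> \<in> space M. Z \<omega> \<in> T \<and> D' \<omega> \<in> E}
        = q * measure M {\<omega> \<in> space M. D' \<omega> \<in> E}"
    and sel: "\<And>\<omega>. \<omega> \<in> space M \<Longrightarrow> Z \<omega> \<in> T \<Longrightarrow> D \<omega> = D' \<omega>"
    and ci: "cond_indep_rvs M (gen_sigma M (\<lambda>\<omega>. fst (D \<omega>)) A) B (\<lambda>\<omega>. snd (D \<omega>)) C Z"
    and u: "cond_exp_version M (gen_sigma M (\<lambda>\<omega>. fst (D \<omega>)) A) (\<lambda>\<omega>. indicator T (Z \<omega>)) u"
    and u01: "\<And>\<omega>. \<omega> \<in> space M \<Longrightarrow> u \<omega> \<in> {0..1}"
  shows "attains_min_second_moment M S D (distr M S D') (\<lambda>\<omega>. u \<omega> / q)"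
proof -
  interpret prob_space M by fact
  let ?F = "gen_sigma M (\<lambda>\<omega>. fst (D \<omega>)) A"
  have X [measurable]: "(\<lambda>\<omega>. fst (D \<omega>)) \<in> measurable M A"
    and Y [measurable]: "(\<lambda>\<omega>. snd (D \<omega>)) \<in> measurable M B"
    using measurable_compose[OF D S(2)] measurable_compose[OF D S(3)] by auto
  have uF: "u \<in> borel_measurable ?F"
    using u by (simp add: cond_exp_version_def)
  have uM [measurable]: "u \<in> borel_measurable M"
    by (rule measurable_from_subalg[OF subalgebra_gen_sigma[OF X] uF])
  \<comment> \<open>Feasibility up to the factor \<open>q\<close>: the propensity is exchanged for
    the indicator of the arm, \<open>D\<close> equals \<open>D'\<close> on that arm, and
    independence splits off the probability \<open>q\<close>.\<close>
  have law_u: "(\<integral>\<^sup>+\<omega>. ennreal (u \<omega>) * indicator E (D \<omega>) \<partial>M) = ennreal q * emeasure (distr M S D') E"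
    if E [measurable]: "E \<in> sets S" for E
  proof -
    \<comment> \<open>The exchange of propensity and indicator is available on the full product
      \<sigma>-algebra, so sets of \<open>S\<close> have to be viewed there.\<close>
    have E' [measurable]: "E \<in> sets (A \<Otimes>\<^sub>M B)" using S(1) E by auto
    have em: "emeasure (distr (density M f) (A \<Otimes>\<^sub>M B) (\<lambda>\<omega>. (fst (D \<omega>), snd (D \<omega>)))) E
        = (\<integral>\<^sup>+\<omega>. f \<omega> * indicator E (D \<omega>) \<partial>M)" if f: "f \<in> borel_measurable M" for f
    proof -
      have "(\<lambda>\<omega>. (fst (D \<omega>), snd (D \<omega>))) \<in> measurable (density M f) (A \<Otimes>\<^sub>M B)"
        by (subst measurable_cong_sets[OF sets_density refl]) (rule measurable_Pair[OF X Y])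
      moreover have "(\<lambda>\<omega>. (fst (D \<omega>), snd (D \<omega>))) -` E \<inter> space M = D -` E \<inter> space M" by simp
      ultimately have "emeasure (distr (density M f) (A \<Otimes>\<^sub>M B) (\<lambda>\<omega>. (fst (D \<omega>), snd (D \<omega>)))) E
          = emeasure (density M f) (D -` E \<inter> space M)"
        using E' by (simp add: emeasure_distr)
      also have "\<dots> = (\<integral>\<^sup>+\<omega>. f \<omega> * indicator E (D \<omega>) \<partial>M)"
        using f by (simp add: emeasure_density) (rule nn_integral_cong, auto simp: indicator_def)
      finally show ?thesis .
    qed
    have "(\<integral>\<^sup>+\<omega>. ennreal (u \<omega>) * indicator E (D \<omega>) \<partial>M)
        = (\<integral>\<^sup>+\<omega>. indicator T (Z \<omega>) * indicator E (D \<omega>) \<partial>M)"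
      using arg_cong[OF cond_indep_distr_density_eq[OF \<open>prob_space M\<close> X Y Z ci T u u01],
          of "\<lambda>N. emeasure N E"]
      by (simp only: em measurable_compose[OF uM measurable_ennreal]
          measurable_compose[OF Z borel_measurable_indicator[OF T]])
    also have "\<dots> = (\<integral>\<^sup>+\<omega>. indicator {\<omega> \<in> space M. Z \<omega> \<in> T \<and> D' \<omega> \<in> E} \<omega> \<partial>M)"
      by (rule nn_integral_cong) (auto simp: indicator_def sel)
    also have "\<dots> = emeasure M {\<omega> \<in> space M. Z \<omega> \<in> T \<and> D' \<omega> \<in> E}"
      by (rule nn_integral_indicator) measurable
    also have "\<dots> = ennreal q * emeasure M {\<omega> \<in> space M. D' \<omega> \<in> E}"
      using q(2) by (simp add: emeasure_eq_measure indep[OF E] ennreal_mult)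
    also have "{\<omega> \<in> space M. D' \<omega> \<in> E} = D' -` E \<inter> space M" by auto
    finally show ?thesis by (simp add: emeasure_distr)
  qed
  have em: "(\<integral>\<^sup>+\<omega>. ennreal (u \<omega> / q) * indicator E (D \<omega>) \<partial>M) = emeasure (distr M S D') E"
    if E [measurable]: "E \<in> sets S" for E
  proof -
    have "(\<integral>\<^sup>+\<omega>. ennreal (u \<omega> / q) * indicator E (D \<omega>) \<partial>M)
        = (\<integral>\<^sup>+\<omega>. ennreal (1 / q) * (ennreal (u \<omega>) * indicator E (D \<omega>)) \<partial>M)"
      by (rule nn_integral_cong)
         (use q(2) u01 in \<open>auto simp: indicator_def ennreal_mult[symmetric]\<close>)
    also have "\<dots> = ennreal (1 / q) * (ennreal q * emeasure (distr M S D') E)"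
      by (simp add: nn_integral_cmult law_u)
    also have "\<dots> = ennreal (1 / q * q) * emeasure (distr M S D') E"
      using q(2) by (subst ennreal_mult) (auto simp: mult.assoc)
    finally show ?thesis using q(2) by simp
  qed
  have int: "integrable M (\<lambda>\<omega>. u \<omega> / q)"
    by (rule integrable_const_bound[where B = "1 / q"])
       (use q(2) u01 in \<open>auto simp: divide_right_mono\<close>)
  \<comment> \<open>The mean is the mass of the weighted law on the whole of \<open>S\<close>, hence
    the total mass of the law of \<open>D'\<close>.\<close>
  have "ennreal (\<integral>\<omega>. u \<omega> / q \<partial>M) = (\<integral>\<^sup>+\<omega>. ennreal (u \<omega> / q) \<partial>M)"
    by (rule nn_integral_eq_integral[OF int, symmetric]) (use q(2) u01 in auto)
  also have "\<dots> = (\<integral>\<^sup>+\<omega>. ennreal (u \<omega> / q) * indicator (space S) (D \<omega>) \<partial>M)"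
    by (rule nn_integral_cong) (use measurable_space[OF D] in auto)
  also have "\<dots> = emeasure (distr M S D') (space S)"
    by (rule em) simp
  also have "\<dots> = 1"
    using prob_space.emeasure_space_1[OF prob_space_distr[OF D']] by simp
  finally have mean: "(\<integral>\<omega>. u \<omega> / q \<partial>M) = 1" by simp
  have w: "(\<lambda>\<omega>. u \<omega> / q) \<in> weights M"
    using int mean q(2) u01 by (auto simp: weights_def)
  have "distr (density M (\<lambda>\<omega>. ennreal (u \<omega> / q))) S D = distr M S D'"
  proof (rule measure_eqI)
    fix E assume "E \<in> sets (distr (density M (\<lambda>\<omega>. ennreal (u \<omega> / q))) S D)"
    then have E [measurable]: "E \<in> sets S" by simp
    have "emeasure (distr (density M (\<lambda>\<omega>. ennreal (u \<omega> / q))) S D) E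
        = (\<integral>\<^sup>+\<omega>. ennreal (u \<omega> / q) * indicator E (D \<omega>) \<partial>M)"
      by (simp add: emeasure_distr emeasure_density)
         (rule nn_integral_cong, auto simp: indicator_def)
    then show "emeasure (distr (density M (\<lambda>\<omega>. ennreal (u \<omega> / q))) S D) E = emeasure (distr M S D') E"
      by (simp add: em)
  qed simp
  then have feas: "(\<lambda>\<omega>. u \<omega> / q) \<in> feasible_weights M S D (distr M S D')"
    using w by (simp add: feasible_weights_def weighted_law_eq_distr[OF w D])
  have DF: "D \<in> measurable (gen_sigma M D S) S"
    by (rule measurable_vimage_algebra1) (use measurable_space[OF D] in auto)
  \<comment> \<open>Measurability of the identity expresses that \<sigma>(fst D) is contained in
    \<sigma>(D); composing with it makes \<open>u\<close> measurable with respect to \<sigma>(D), as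
    the minimality criterion demands.\<close>
  have "(\<lambda>\<omega>. \<omega>) \<in> measurable (gen_sigma M D S) ?F"
    by (rule measurable_vimage_algebra2) (use measurable_compose[OF DF S(2)] in auto)
  from measurable_compose[OF this uF]
  have [measurable]: "u \<in> borel_measurable (gen_sigma M D S)" .
  \<comment> \<open>Since \<open>u\<close> lies in [0,1], the weight is bounded by 1 / q.\<close>
  have "second_moment M (\<lambda>\<omega>. u \<omega> / q) \<le> (\<integral>\<^sup>+\<omega>. ennreal ((1 / q)\<^sup>2) \<partial>M)"
    unfolding second_moment_def
    by (intro nn_integral_mono ennreal_leI power_mono divide_right_mono) (use q(2) u01 in auto)
  then have fin: "second_moment M (\<lambda>\<omega>. u \<omega> / q) < \<infinity>"
    by (rule order.strict_trans1) (simp add: emeasure_space_1 ennreal_mult_less_top)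
  show ?thesis
    by (rule attains_min_second_moment_if_measurable[OF D feas _ fin]) measurable
qed

text \<open>Treatment and control are the same situation with the roles exchanged: the arm {1} has
  probability \<open>p\<close> and propensity \<open>e\<close>, the arm {0} has probability 1 - p
  and propensity 1 - e. It remains to derive the assumptions on each arm from those on
  \<open>Z\<close> and on the pair of potential data points.\<close>

theorem theorem1:
  fixes M :: "'w measure"
    and \<X> :: "(real ^ 'd) set" and \<Y> :: "(real ^ 'm) set"
    and p :: real
    and D\<^sub>C D\<^sub>T D\<^sub>E :: "'w \<Rightarrow> (real ^ 'd) \<times> (real ^ 'm)"
    and X\<^sub>E :: "'w \<Rightarrow> real ^ 'd" and Y\<^sub>E :: "'w \<Rightarrow> real ^ 'm"
    and Z :: "'w \<Rightarrow> real"
    and e :: "'w \<Rightarrow> real"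
    and S :: "((real ^ 'd) \<times> (real ^ 'm)) measure"
  assumes prob: "prob_space M"
    and X_borel: "\<X> \<in> sets borel" and Y_borel: "\<Y> \<in> sets borel"
    and S: "S = restrict_space borel (\<X> \<times> \<Y>)"
    and p: "0 < p" "p < 1"
    and DC: "D\<^sub>C \<in> measurable M S"
    and DT: "D\<^sub>T \<in> measurable M S"
    and Z: "Z \<in> borel_measurable M" "\<And>\<omega>. \<omega> \<in> space M \<Longrightarrow> Z \<omega> \<in> {0, 1}"
    and Z_prob: "measure M {\<omega> \<in> space M. Z \<omega> = 1} = p"
    and Z_indep: "indep_rvs M borel Z (S \<Otimes>\<^sub>M S) (\<lambda>\<omega>. (D\<^sub>C \<omega>, D\<^sub>T \<omega>))"
    and DE: "\<And>\<omega>. D\<^sub>E \<omega> = Z \<omega> *\<^sub>R D\<^sub>T \<omega> + (1 - Z \<omega>) *\<^sub>R D\<^sub>C \<omega>"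
    and XE: "\<And>\<omega>. X\<^sub>E \<omega> = fst (D\<^sub>E \<omega>)" and YE: "\<And>\<omega>. Y\<^sub>E \<omega> = snd (D\<^sub>E \<omega>)"
    and cond_indep: "cond_indep_rvs M (gen_sigma M X\<^sub>E borel) borel Y\<^sub>E borel Z"
    and e: "cond_exp_version M (gen_sigma M X\<^sub>E borel) Z e"
           "\<And>\<omega>. \<omega> \<in> space M \<Longrightarrow> e \<omega> \<in> {0..1}"
  shows "attains_min_second_moment M S D\<^sub>E (distr M S D\<^sub>T) (\<lambda>\<omega>. e \<omega> / p)
      \<and> attains_min_second_moment M S D\<^sub>E (distr M S D\<^sub>C) (\<lambda>\<omega>. (1 - e \<omega>) / (1 - p))"
proof -
  interpret prob_space M by fact
  note [measurable] = DC DT Z(1)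
  let ?F = "gen_sigma M X\<^sub>E borel"
  let ?U = "\<lambda>c \<omega>. indicator {c} (Z \<omega>) :: real"
  have XY: "\<X> \<times> \<Y> \<in> sets borel"
    using X_borel Y_borel by (simp add: borel_prod[symmetric])
  have S1: "sets S \<subseteq> sets (borel \<Otimes>\<^sub>M borel)"
    unfolding S borel_prod using XY by (auto simp: sets_restrict_space_iff)
  have S2: "fst \<in> measurable S borel" and S3: "snd \<in> measurable S borel"
    unfolding S by (auto intro!: measurable_restrict_space1 borel_measurable_continuous_onI
        continuous_intros)
  have DE0: "D\<^sub>E \<omega> = D\<^sub>C \<omega>" if "Z \<omega> \<in> {0}" for \<omega> using that by (simp add: DE)
  have DE1: "D\<^sub>E \<omega> = D\<^sub>T \<omega>" if "Z \<omega> \<in> {1}" for \<omega> using that by (simp add: DE)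
  \<comment> \<open>The values of \<open>Z\<close> are restricted to 0 and 1 only on
    \<open>space M\<close>, where the linear combination becomes a case distinction between two
    \<open>S\<close>-valued variables. This also keeps \<open>D\<^sub>E\<close> inside the possibly
    non-convex set \<open>\<X> \<times> \<Y>\<close>.\<close>
  have D: "D\<^sub>E \<in> measurable M S"
  proof -
    have "(\<lambda>\<omega>. if Z \<omega> = 1 then D\<^sub>T \<omega> else D\<^sub>C \<omega>) \<in> measurable M S" by measurable
    also have "?this \<longleftrightarrow> D\<^sub>E \<in> measurable M S"
      by (rule measurable_cong) (use Z(2) DE0 DE1 in fastforce)
    finally show ?thesis .
  qed
  have XE': "X\<^sub>E = (\<lambda>\<omega>. fst (D\<^sub>E \<omega>))" and YE': "Y\<^sub>E = (\<lambda>\<omega>. snd (D\<^sub>E \<omega>))"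
    using XE YE by auto
  have X: "X\<^sub>E \<in> measurable M borel"
    unfolding XE' by (rule measurable_compose[OF D S2])
  have indep: "measure M {\<omega> \<in> space M. Z \<omega> \<in> T \<and> (D\<^sub>C \<omega>, D\<^sub>T \<omega>) \<in> E}
      = measure M {\<omega> \<in> space M. Z \<omega> \<in> T} * measure M {\<omega> \<in> space M. (D\<^sub>C \<omega>, D\<^sub>T \<omega>) \<in> E}"
    if "T \<in> sets borel" "E \<in> sets (S \<Otimes>\<^sub>M S)" for T E
  proof -
    have "Z -` T \<inter> space M \<in> sets (gen_sigma M Z borel)"
      "(\<lambda>\<omega>. (D\<^sub>C \<omega>, D\<^sub>T \<omega>)) -` E \<inter> space M \<in> sets (gen_sigma M (\<lambda>\<omega>. (D\<^sub>C \<omega>, D\<^sub>T \<omega>)) (S \<Otimes>\<^sub>M S))"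
      using that by (auto intro: in_vimage_algebra)
    from indep_setD[OF _ this] Z_indep
    have "prob ((Z -` T \<inter> space M) \<inter> ((\<lambda>\<omega>. (D\<^sub>C \<omega>, D\<^sub>T \<omega>)) -` E \<inter> space M))
        = prob (Z -` T \<inter> space M) * prob ((\<lambda>\<omega>. (D\<^sub>C \<omega>, D\<^sub>T \<omega>)) -` E \<inter> space M)"
      by (simp add: indep_rvs_def)
    moreover have "(Z -` T \<inter> space M) \<inter> ((\<lambda>\<omega>. (D\<^sub>C \<omega>, D\<^sub>T \<omega>)) -` E \<inter> space M)
        = {\<omega> \<in> space M. Z \<omega> \<in> T \<and> (D\<^sub>C \<omega>, D\<^sub>T \<omega>) \<in> E}"
      "Z -` T \<inter> space M = {\<omega> \<in> space M. Z \<omega> \<in> T}"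
      "(\<lambda>\<omega>. (D\<^sub>C \<omega>, D\<^sub>T \<omega>)) -` E \<inter> space M = {\<omega> \<in> space M. (D\<^sub>C \<omega>, D\<^sub>T \<omega>) \<in> E}"
      by auto
    ultimately show ?thesis by simp
  qed
  have spC: "D\<^sub>C \<omega> \<in> space S" and spT: "D\<^sub>T \<omega> \<in> space S" if "\<omega> \<in> space M" for \<omega>
    using that measurable_space[OF DC] measurable_space[OF DT] by auto
  \<comment> \<open>Independence from the pair passes to a single component through cylinder sets:
    the other component always lies in \<open>space S\<close>, so it imposes no condition.\<close>
  have indepT: "measure M {\<omega> \<in> space M. Z \<omega> \<in> T \<and> D\<^sub>T \<omega> \<in> E}
      = measure M {\<omega> \<in> space M. Z \<omega> \<in> T} * measure M {\<omega> \<in> space M. D\<^sub>T \<omega> \<in> E}"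
    if "T \<in> sets borel" "E \<in> sets S" for T E
    using indep[of T "space S \<times> E"] that spC by (simp add: conj_commute cong: conj_cong)
  have indepC: "measure M {\<omega> \<in> space M. Z \<omega> \<in> T \<and> D\<^sub>C \<omega> \<in> E}
      = measure M {\<omega> \<in> space M. Z \<omega> \<in> T} * measure M {\<omega> \<in> space M. D\<^sub>C \<omega> \<in> E}"
    if "T \<in> sets borel" "E \<in> sets S" for T E
    using indep[of T "E \<times> space S"] that spT by (simp add: conj_commute cong: conj_cong)
  have q1: "measure M {\<omega> \<in> space M. Z \<omega> \<in> {1}} = p"
    using Z_prob by simp
  have "{\<omega> \<in> space M. Z \<omega> \<in> {0}} = space M - {\<omega> \<in> space M. Z \<omega> = 1}"
    using Z(2) by auto
  then have q0: "measure M {\<omega> \<in> space M. Z \<omega> \<in> {0}} = 1 - p"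
    by (simp add: prob_compl Z_prob)
  interpret F: finite_measure_subalgebra M ?F
    by unfold_locales (rule subalgebra_gen_sigma[OF X])
  have intZ: "integrable M Z"
    by (rule integrable_const_bound[where B = 1]) (use Z(2) in fastforce)+
  have eF [measurable]: "e \<in> borel_measurable ?F"
    and eAE: "AE \<omega> in M. e \<omega> = real_cond_exp M ?F Z \<omega>"
    using e(1) by (auto simp: cond_exp_version_def)
  \<comment> \<open>A {0,1}-valued \<open>Z\<close> is its own indicator of {1}.\<close>
  have ce1: "cond_exp_version M ?F (?U 1) e"
  proof -
    have "AE \<omega> in M. real_cond_exp M ?F Z \<omega> = real_cond_exp M ?F (?U 1) \<omega>"
      by (rule F.real_cond_exp_cong) (use Z(2) in \<open>auto simp: indicator_def\<close>)
    with eAE have "AE \<omega> in M. e \<omega> = real_cond_exp M ?F (?U 1) \<omega>"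
      by eventually_elim simp
    with eF show ?thesis by (simp add: cond_exp_version_def)
  qed
  \<comment> \<open>Here I{Z = 0} = 1 - Z, and linearity of conditional expectation gives the
    complementary propensity.\<close>
  have ce0: "cond_exp_version M ?F (?U 0) (\<lambda>\<omega>. 1 - e \<omega>)"
  proof -
    have "AE \<omega> in M. real_cond_exp M ?F (\<lambda>\<omega>. 1 - Z \<omega>) \<omega> = real_cond_exp M ?F (?U 0) \<omega>"
      by (rule F.real_cond_exp_cong) (use Z(2) in \<open>auto simp: indicator_def\<close>)
    moreover have "AE \<omega> in M. real_cond_exp M ?F (\<lambda>\<omega>. 1 - Z \<omega>) \<omega>
        = real_cond_exp M ?F (\<lambda>_. 1) \<omega> - real_cond_exp M ?F Z \<omega>"
      by (rule F.real_cond_exp_diff) (use intZ in auto)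
    moreover have "AE \<omega> in M. real_cond_exp M ?F (\<lambda>_. 1) \<omega> = 1"
      by (rule F.real_cond_exp_F_meas) auto
    ultimately have "AE \<omega> in M. 1 - e \<omega> = real_cond_exp M ?F (?U 0) \<omega>"
      using eAE by eventually_elim simp
    then show ?thesis by (simp add: cond_exp_version_def)
  qed
  note ci = cond_indep[unfolded XE' YE']
  show ?thesis
  proof
    show "attains_min_second_moment M S D\<^sub>E (distr M S D\<^sub>T) (\<lambda>\<omega>. e \<omega> / p)"
      by (rule attains_min_second_moment_propensity[OF prob S1 S2 S3 DT D Z(1) _ q1 p(1) _ _ ci
            ce1[unfolded XE'] e(2)])
         (auto simp: indepT[of "{1}", simplified] Z_prob DE1)
    show "attains_min_second_moment M S D\<^sub>E (distr M S D\<^sub>C) (\<lambda>\<omega>. (1 - e \<omega>) / (1 - p))"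
      by (rule attains_min_second_moment_propensity[OF prob S1 S2 S3 DC D Z(1) _ q0 _ _ _ ci
            ce0[unfolded XE']])
         (use p(2) e(2) q0 in \<open>auto simp: indepC[of "{0}", simplified] DE0\<close>)
  qed
qed

end
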